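(* Let $V\in\{0,1\}^{\mathbb{N}}$ be a spacer rank-two word such that for all spacer rank-two constructions of $V$, the first word in the construction appears infinitely many times (i.e. for every spacer rank-two construction of $V$ with levels $\{v_{n,1},v_{n,2}\}$, $n\in\mathbb{N}$, the word $v_{n,1}$ appears infinitely many times in $V$ for every $n$). Then $(X_V,\sigma)$ is a spacer rank-two system.
   Context: Building: $\mathbb{N}$ is the set of nonnegative integers; $\mathcal{F}$ is the set of all finite binary words that start and end with $0$; $1^a$ is $a$ consecutive $1$s. For finite $S\subset\mathcal{F}$, a building of a finite word $w$ from $S$ is an expression $w=u_11^{a_1}u_21^{a_2}\cdots u_k1^{a_k}u_{k+1}$ with $k\ge 1$, $u_i\in S$, $a_i\in\mathbb{N}$ (it starts with $u$ if $u_1=u$); a building of an infinite word from $S$ is an expression $u_11^{a_1}u_21^{a_2}\cdots$ of the same kind. A word is built from $S$ (starting with $u$) if it has a building from $S$ (starting with $u$). An infinite word $V$ has a rank-one construction (is a rank-one word) if there is a sequence $(v_i)_{i\in\mathbb{N}}$ in $\mathcal{F}$ with $v_0=0$, $v_{i+1}$ built from $\{v_i\}$ and $v_i$ an initial segment of $V$ for all $i$. A spacer rank-two construction of a word $V$ which has no rank-one construction consists of sets (levels) $S_n=\{v_{n,1},v_{n,2}\}\subset\mathcal{F}$, $n\in\mathbb{N}$, with $v_{0,1}=v_{0,2}=0$, $v_{n+1,1}$ built from $S_n$ starting with $v_{n,1}$, $v_{n+1,2}$ built from $S_n$, and $v_{n,1}$ an initial segment of $V$ for all $n$. A spacer rank-two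 word is a word with a spacer rank-two construction (in particular without a rank-one construction). Since the building of $v_{m+1,1}$ starts with $v_{m,1}$ for all $m$, composing the buildings in the construction gives, for each $n$, a building of $V$ from $S_n$. An appearance of $v_{n,1}$ in $V$ means an expected appearance, i.e. a term equal to $v_{n,1}$ in this building of $V$ from $S_n$ (not merely an occurrence as a subword). $X_V=\{x\in\{0,1\}^{\mathbb{Z}}:\text{every finite subword of }x\text{ is a subword of }V\}$, with the shift $\sigma(x)(i)=x(i+1)$. A subshift $X$ is a spacer rank-two system if $X=X_W$ for some word $W$ with a spacer rank-two construction and there is no rank-one word $W'$ with $X=X_{W'}$. *)

theory Defs
  imports "HOL-Analysis.Analysis" "HOL-Library.Z2"
begin

type_synonym fword = "bit list"
type_synonym iword = "nat \<Rightarrow> bit"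

definition F_words :: "fword set" where
  "F_words = {w. w \<noteq> [] \<and> hd w = 0 \<and> last w = 0}"

definition initial_segment :: "fword \<Rightarrow> iword \<Rightarrow> bool" where
  "initial_segment w V \<longleftrightarrow> w = map V [0..<length w]"

section \<open>Buildings\<close>

text \<open>The expression \<open>u\<^sub>1 1^a\<^sub>1 u\<^sub>2 1^a\<^sub>2 \<dots> u\<^sub>k 1^a\<^sub>k u'\<close> is represented by
  \<open>([(u\<^sub>1, a\<^sub>1), \<dots>, (u\<^sub>k, a\<^sub>k)], u')\<close>. It is kept separate from the word it spells, because
  a word may have several buildings from the same set.\<close>

type_synonym building = "(fword \<times> nat) list \<times> fword"

definition spell :: "(fword \<times> nat) list \<Rightarrow> fword" where
  "spell ps = concat (map (\<lambda>(u, a). u @ replicate a 1) ps)"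

definition building_word :: "building \<Rightarrow> fword" where
  "building_word b = spell (fst b) @ snd b"

definition building_terms :: "building \<Rightarrow> fword list" where
  "building_terms b = map fst (fst b) @ [snd b]"

definition is_building :: "fword set \<Rightarrow> fword \<Rightarrow> building \<Rightarrow> bool" where
  "is_building S w b \<longleftrightarrow>
     length (fst b) \<ge> 1 \<and> set (building_terms b) \<subseteq> S \<and> building_word b = w"

definition starts_with :: "fword \<Rightarrow> building \<Rightarrow> bool" where
  "starts_with u b \<longleftrightarrow> hd (building_terms b) = u"

definition built_from :: "fword set \<Rightarrow> fword \<Rightarrow> bool" where
  "built_from S w \<longleftrightarrow> (\<exists>b. is_building S w b)"

definition built_from_starting :: "fword set \<Rightarrow> fword \<Rightarrow> fword \<Rightarrow> bool" where
  "built_from_starting S u w \<longleftrightarrow> (\<exists>b. is_building S w b \<and> starts_with u b)"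

definition is_infinite_building :: "fword set \<Rightarrow> iword \<Rightarrow> (nat \<Rightarrow> fword \<times> nat) \<Rightarrow> bool" where
  "is_infinite_building S V e \<longleftrightarrow>
     (\<forall>i. fst (e i) \<in> S) \<and> (\<forall>n. initial_segment (spell (map e [0..<n])) V)"

section \<open>Rank-one words and spacer rank-two constructions\<close>

definition rank_one_word :: "iword \<Rightarrow> bool" where
  "rank_one_word V \<longleftrightarrow>
     (\<exists>v :: nat \<Rightarrow> fword. (\<forall>i. v i \<in> F_words) \<and> v 0 = [0] \<and>
        (\<forall>i. built_from {v i} (v (Suc i))) \<and> (\<forall>i. initial_segment (v i) V))"

definition level :: "(nat \<Rightarrow> fword) \<Rightarrow> (nat \<Rightarrow> fword) \<Rightarrow> nat \<Rightarrow> fword set" where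
  "level v1 v2 n = {v1 n, v2 n}"

definition spacer_rank_two_construction ::
  "iword \<Rightarrow> (nat \<Rightarrow> fword) \<Rightarrow> (nat \<Rightarrow> fword) \<Rightarrow> bool" where
  "spacer_rank_two_construction V v1 v2 \<longleftrightarrow>
     \<not> rank_one_word V \<and>
     (\<forall>n. level v1 v2 n \<subseteq> F_words) \<and>
     v1 0 = [0] \<and> v2 0 = [0] \<and>
     (\<forall>n. built_from_starting (level v1 v2 n) (v1 n) (v1 (Suc n))) \<and>
     (\<forall>n. built_from (level v1 v2 n) (v2 (Suc n))) \<and>
     (\<forall>n. initial_segment (v1 n) V)"

definition spacer_rank_two_word :: "iword \<Rightarrow> bool" where
  "spacer_rank_two_word V \<longleftrightarrow> (\<exists>v1 v2. spacer_rank_two_construction V v1 v2)"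

section \<open>Expected appearances\<close>

text \<open>\<open>B n w\<close> is the building from level \<open>n\<close> chosen for the word \<open>w\<close> of level \<open>n + 1\<close>.
  Levels are sets of words, so if both words of level \<open>n + 1\<close> coincide they share one building,
  which starts with \<open>v1 n\<close>.\<close>

definition construction_buildings ::
  "(nat \<Rightarrow> fword) \<Rightarrow> (nat \<Rightarrow> fword) \<Rightarrow> (nat \<Rightarrow> fword \<Rightarrow> building) \<Rightarrow> bool" where
  "construction_buildings v1 v2 B \<longleftrightarrow>
     (\<forall>n. is_building (level v1 v2 n) (v1 (Suc n)) (B n (v1 (Suc n))) \<and>
          starts_with (v1 n) (B n (v1 (Suc n))) \<and>
          is_building (level v1 v2 n) (v2 (Suc n)) (B n (v2 (Suc n))))"

text \<open>Composition of buildings: every term \<open>u\<close> of \<open>b\<close> is replaced by the expression \<open>\<beta> u\<close>.\<close>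

definition subst_pairs :: "(fword \<Rightarrow> building) \<Rightarrow> (fword \<times> nat) list \<Rightarrow> (fword \<times> nat) list" where
  "subst_pairs \<beta> ps = concat (map (\<lambda>(u, a). fst (\<beta> u) @ [(snd (\<beta> u), a)]) ps)"

definition subst_building :: "(fword \<Rightarrow> building) \<Rightarrow> building \<Rightarrow> building" where
  "subst_building \<beta> b = (subst_pairs \<beta> (fst b) @ fst (\<beta> (snd b)), snd (\<beta> (snd b)))"

text \<open>\<open>composed B n k w\<close> is the resulting building, from level \<open>n\<close>, of the word \<open>w\<close> of level
  \<open>n + k\<close>; for \<open>k = 0\<close> it is the one-term expression \<open>w\<close>.\<close>

fun composed :: "(nat \<Rightarrow> fword \<Rightarrow> building) \<Rightarrow> nat \<Rightarrow> nat \<Rightarrow> fword \<Rightarrow> building" where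
  "composed B n 0 w = ([], w)"
| "composed B n (Suc k) w = subst_building (composed B n k) (B (n + k) w)"

text \<open>The building of the infinite word from level \<open>n\<close>. The composed buildings of \<open>v1 (n + k)\<close>,
  \<open>k = 0, 1, 2, \<dots>\<close>, extend one another and the \<open>k\<close>-th one has at least \<open>k\<close> pairs, so that the
  \<open>i\<close>-th pair (counting from \<open>0\<close>) can be read off from the one with \<open>k = i + 1\<close>; see
  \<open>expected_building_extends\<close> and \<open>expected_building_is_infinite_building\<close>.\<close>

definition expected_building ::
  "(nat \<Rightarrow> fword) \<Rightarrow> (nat \<Rightarrow> fword \<Rightarrow> building) \<Rightarrow> nat \<Rightarrow> nat \<Rightarrow> fword \<times> nat" where
  "expected_building v1 B n i = fst (composed B n (Suc i) (v1 (n + Suc i))) ! i"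

definition first_word_appears_infinitely_often ::
  "(nat \<Rightarrow> fword) \<Rightarrow> (nat \<Rightarrow> fword \<Rightarrow> building) \<Rightarrow> nat \<Rightarrow> bool" where
  "first_word_appears_infinitely_often v1 B n \<longleftrightarrow>
     infinite {i. fst (expected_building v1 B n i) = v1 n}"

section \<open>Subshifts\<close>

definition shift :: "(int \<Rightarrow> bit) \<Rightarrow> int \<Rightarrow> bit" where
  "shift x = (\<lambda>i. x (i + 1))"

definition subshift :: "(int \<Rightarrow> bit) set \<Rightarrow> bool" where
  "subshift X \<longleftrightarrow>
     closedin (product_topology (\<lambda>_. discrete_topology UNIV) UNIV) X \<and> shift ` X = X"

definition subword :: "fword \<Rightarrow> iword \<Rightarrow> bool" where
  "subword w V \<longleftrightarrow> (\<exists>i. w = map (\<lambda>j. V (i + j)) [0..<length w])"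

definition subword_Z :: "fword \<Rightarrow> (int \<Rightarrow> bit) \<Rightarrow> bool" where
  "subword_Z w x \<longleftrightarrow> (\<exists>i. w = map (\<lambda>j. x (i + int j)) [0..<length w])"

definition X_of :: "iword \<Rightarrow> (int \<Rightarrow> bit) set" where
  "X_of V = {x. \<forall>w. subword_Z w x \<longrightarrow> subword w V}"

definition spacer_rank_two_system :: "(int \<Rightarrow> bit) set \<Rightarrow> bool" where
  "spacer_rank_two_system X \<longleftrightarrow>
     subshift X \<and>
     (\<exists>W. spacer_rank_two_word W \<and> X = X_of W) \<and>
     \<not> (\<exists>W'. rank_one_word W' \<and> X = X_of W')"

section \<open>Composing buildings\<close>

lemma spell_append [simp]: "spell (ps @ qs) = spell ps @ spell qs"
  by (simp add: spell_def)

lemma spell_Nil [simp]: "spell [] = []"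
  by (simp add: spell_def)

lemma spell_Cons [simp]: "spell (p # ps) = fst p @ replicate (snd p) 1 @ spell ps"
  by (simp add: spell_def split: prod.split)

lemma subst_pairs_Nil [simp]: "subst_pairs \<beta> [] = []"
  by (simp add: subst_pairs_def)

lemma subst_pairs_Cons [simp]:
  "subst_pairs \<beta> (p # ps) = fst (\<beta> (fst p)) @ (snd (\<beta> (fst p)), snd p) # subst_pairs \<beta> ps"
  by (simp add: subst_pairs_def split: prod.split)

lemma spell_subst_pairs:
  assumes "\<And>u. u \<in> fst ` set ps \<Longrightarrow> building_word (\<beta> u) = u"
  shows "spell (subst_pairs \<beta> ps) = spell ps"
  using assms
proof (induction ps)
  case (Cons p ps)
  have "building_word (\<beta> (fst p)) = fst p"
    using Cons.prems by simp
  then have "spell (fst (\<beta> (fst p))) @ snd (\<beta> (fst p)) = fst p"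
    by (simp add: building_word_def)
  moreover have "spell (subst_pairs \<beta> ps) = spell ps"
    using Cons by simp
  ultimately show ?case
    by (metis append.assoc fst_conv snd_conv spell_Cons spell_append subst_pairs_Cons)
qed simp

lemma subst_building_word:
  assumes "\<And>u. u \<in> set (building_terms b) \<Longrightarrow> building_word (\<beta> u) = u"
  shows "building_word (subst_building \<beta> b) = building_word b"
proof -
  have "spell (subst_pairs \<beta> (fst b)) = spell (fst b)"
    by (rule spell_subst_pairs) (use assms in \<open>auto simp: building_terms_def\<close>)
  moreover have "spell (fst (\<beta> (snd b))) @ snd (\<beta> (snd b)) = snd b"
    using assms[of "snd b"] by (simp add: building_terms_def building_word_def)
  ultimately show ?thesis
    by (simp add: building_word_def subst_building_def)
qed

lemma subst_pairs_terms:
  assumes "\<And>u. u \<in> fst ` set ps \<Longrightarrow> set (building_terms (\<beta> u)) \<subseteq> S"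
  shows "fst ` set (subst_pairs \<beta> ps) \<subseteq> S"
  using assms
proof (induction ps)
  case (Cons p ps)
  have "set (building_terms (\<beta> (fst p))) \<subseteq> S" "fst ` set (subst_pairs \<beta> ps) \<subseteq> S"
    using Cons by auto
  then show ?case
    by (auto simp: building_terms_def)
qed simp

lemma subst_building_terms:
  assumes "\<And>u. u \<in> set (building_terms b) \<Longrightarrow> set (building_terms (\<beta> u)) \<subseteq> S"
  shows "set (building_terms (subst_building \<beta> b)) \<subseteq> S"
proof -
  have "fst ` set (subst_pairs \<beta> (fst b)) \<subseteq> S"
    by (rule subst_pairs_terms) (use assms in \<open>auto simp: building_terms_def\<close>)
  moreover have "set (building_terms (\<beta> (snd b))) \<subseteq> S"
    by (rule assms) (simp add: building_terms_def)
  ultimately show ?thesis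
    by (auto simp: building_terms_def subst_building_def)
qed

lemma composed_building:
  assumes "construction_buildings v1 v2 B" "w \<in> level v1 v2 (n + k)"
  shows "set (building_terms (composed B n k w)) \<subseteq> level v1 v2 n
       \<and> building_word (composed B n k w) = w"
  using assms(2)
proof (induction k arbitrary: w)
  case 0
  then show ?case
    by (simp add: building_terms_def building_word_def)
next
  case (Suc k)
  have b: "is_building (level v1 v2 (n + k)) w (B (n + k) w)"
    using Suc.prems assms(1) by (auto simp: level_def construction_buildings_def)
  then have "u \<in> level v1 v2 (n + k)" if "u \<in> set (building_terms (B (n + k) w))" for u
    using that by (auto simp: is_building_def)
  with Suc.IH have
    "set (building_terms (subst_building (composed B n k) (B (n + k) w))) \<subseteq> level v1 v2 n"
    "building_word (subst_building (composed B n k) (B (n + k) w)) = building_word (B (n + k) w)"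
    by (auto intro!: subst_building_terms subst_building_word)
  with b show ?case
    by (simp add: is_building_def)
qed

lemma composed_extends:
  assumes "construction_buildings v1 v2 B"
  shows "\<exists>p ps. fst (composed B n (Suc k) (v1 (n + Suc k)))
               = fst (composed B n k (v1 (n + k))) @ p # ps"
proof -
  let ?b = "B (n + k) (v1 (n + Suc k))"
  have b: "is_building (level v1 v2 (n + k)) (v1 (n + Suc k)) ?b" "starts_with (v1 (n + k)) ?b"
    using assms by (auto simp: construction_buildings_def)
  then obtain p ps where p: "fst ?b = p # ps"
    by (cases "fst ?b") (auto simp: is_building_def)
  with b have "fst p = v1 (n + k)"
    by (simp add: starts_with_def building_terms_def)
  with p show ?thesis
    by (simp add: subst_building_def)
qed

lemma composed_extends_le:
  assumes "construction_buildings v1 v2 B" "k \<le> m"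
  shows "\<exists>ps. fst (composed B n m (v1 (n + m))) = fst (composed B n k (v1 (n + k))) @ ps"
  using assms(2)
proof (induction m rule: dec_induct)
  case (step m)
  then show ?case
    using composed_extends[OF assms(1), of n m] by auto
qed simp

lemma length_composed:
  assumes "construction_buildings v1 v2 B"
  shows "k \<le> length (fst (composed B n k (v1 (n + k))))"
proof (induction k)
  case (Suc k)
  then show ?case
    using composed_extends[OF assms, of n k] by auto
qed simp

lemma expected_building_extends:
  assumes "construction_buildings v1 v2 B"
  shows "fst (composed B n k (v1 (n + k)))
       = map (expected_building v1 B n) [0..<length (fst (composed B n k (v1 (n + k))))]"
proof (rule nth_equalityI)
  fix i
  let ?c = "\<lambda>k. fst (composed B n k (v1 (n + k)))"
  assume i: "i < length (?c k)"
  have i': "i < length (?c (Suc i))"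
    using length_composed[OF assms, of "Suc i" n] by linarith
  have "?c k ! i = ?c (Suc i) ! i"
  proof (cases "k \<le> Suc i")
    case True
    then show ?thesis
      using composed_extends_le[OF assms, of k "Suc i" n] i by (metis nth_append)
  next
    case False
    then show ?thesis
      using composed_extends_le[OF assms, of "Suc i" k n] i' by (metis nat_le_linear nth_append)
  qed
  with i show "?c k ! i = map (expected_building v1 B n) [0..<length (?c k)] ! i"
    by (simp add: expected_building_def del: composed.simps)
qed simp

lemma initial_segment_append:
  assumes "initial_segment (u @ w) V"
  shows "initial_segment u V"
proof -
  have "take (length u) (u @ w) = take (length u) (map V [0..<length (u @ w)])"
    using assms unfolding initial_segment_def by (rule arg_cong)
  then show ?thesis
    by (simp add: initial_segment_def take_map)
qed

lemma expected_building_is_infinite_building: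
  assumes "spacer_rank_two_construction V v1 v2" "construction_buildings v1 v2 B"
  shows "is_infinite_building (level v1 v2 n) V (expected_building v1 B n)"
  unfolding is_infinite_building_def
proof (intro conjI allI)
  fix i
  let ?e = "expected_building v1 B n"
  let ?c = "\<lambda>k. composed B n k (v1 (n + k))"
  have c: "set (building_terms (?c k)) \<subseteq> level v1 v2 n" "building_word (?c k) = v1 (n + k)" for k
    using composed_building[OF assms(2), of "v1 (n + k)" n k] by (auto simp: level_def)
  have "?e i \<in> set (fst (?c (Suc i)))"
    unfolding expected_building_def
    using length_composed[OF assms(2), of "Suc i" n] by (intro nth_mem) linarith
  then show "fst (?e i) \<in> level v1 v2 n"
    using c(1)[of "Suc i"] by (auto simp: building_terms_def simp del: composed.simps)
  have "[0..<length (fst (?c i))] = [0..<i] @ [i..<length (fst (?c i))]"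
    using length_composed[OF assms(2), of i n]
    by (metis le_add_diff_inverse upt_add_eq_append zero_le)
  then have "fst (?c i) = map ?e [0..<i] @ map ?e [i..<length (fst (?c i))]"
    using expected_building_extends[OF assms(2), of n i] by (metis map_append)
  then have "v1 (n + i)
      = spell (map ?e [0..<i]) @ spell (map ?e [i..<length (fst (?c i))]) @ snd (?c i)"
    using c(2)[of i] unfolding building_word_def by (metis append.assoc spell_append)
  moreover have "initial_segment (v1 (n + i)) V"
    using assms(1) by (simp add: spacer_rank_two_construction_def)
  ultimately show "initial_segment (spell (map ?e [0..<i])) V"
    by (metis initial_segment_append)
qed

section \<open>\<open>X_of V\<close> is a subshift\<close>

lemma subword_Z_shift: "subword_Z w (shift x) \<longleftrightarrow> subword_Z w x"
proof -
  have "(\<exists>i. w = map (\<lambda>j. x (i + int j + 1)) [0..<length w]) \<longleftrightarrow>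
        (\<exists>i. w = map (\<lambda>j. x (i + int j)) [0..<length w])" (is "?L \<longleftrightarrow> ?R")
  proof
    assume ?L
    then obtain i where "w = map (\<lambda>j. x (i + int j + 1)) [0..<length w]" ..
    then have "w = map (\<lambda>j. x ((i + 1) + int j)) [0..<length w]"
      by (simp add: add_ac)
    then show ?R ..
  next
    assume ?R
    then obtain i where "w = map (\<lambda>j. x (i + int j)) [0..<length w]" ..
    then have "w = map (\<lambda>j. x ((i - 1) + int j + 1)) [0..<length w]"
      by (simp add: algebra_simps)
    then show ?L ..
  qed
  then show ?thesis
    by (simp add: subword_Z_def shift_def)
qed

lemma subshift_X_of: "subshift (X_of V)"
proof -
  let ?T = "product_topology (\<lambda>_ :: int. discrete_topology (UNIV :: bit set)) UNIV"
  have "openin ?T (- X_of V)"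
  proof (subst openin_subopen, intro ballI)
    fix x assume "x \<in> - X_of V"
    then obtain w i where w: "w = map (\<lambda>j. x (i + int j)) [0..<length w]" "\<not> subword w V"
      by (auto simp: X_of_def subword_Z_def)
    let ?U = "\<Inter>j\<in>{..length w}. {y. y (i + int j) = x (i + int j)}"
    have "openin ?T {y. y k = c}" for k c
    proof -
      have "continuous_map ?T (discrete_topology UNIV) (\<lambda>y. y k)"
        by (rule continuous_map_product_projection) simp
      then have "openin ?T {y \<in> topspace ?T. y k \<in> {c}}"
        by (rule openin_continuous_map_preimage) simp
      then show ?thesis
        by simp
    qed
    then have "openin ?T ?U"
      by (intro openin_INT2) auto
    moreover have "?U \<subseteq> - X_of V"
    proof
      fix y assume "y \<in> ?U"
      then have "w = map (\<lambda>j. y (i + int j)) [0..<length w]"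
        by (subst w(1)) auto
      with w(2) show "y \<in> - X_of V"
        by (auto simp: X_of_def subword_Z_def)
    qed
    moreover have "x \<in> ?U"
      by simp
    ultimately show "\<exists>U. openin ?T U \<and> x \<in> U \<and> U \<subseteq> - X_of V"
      by blast
  qed
  then have "closedin ?T (X_of V)"
    by (simp add: closedin_def Compl_eq_Diff_UNIV)
  moreover have "shift ` X_of V = X_of V"
  proof (intro equalityI subsetI)
    fix x assume "x \<in> shift ` X_of V"
    then show "x \<in> X_of V"
      by (auto simp: X_of_def subword_Z_shift)
  next
    fix x assume x: "x \<in> X_of V"
    have s: "shift (\<lambda>i. x (i - 1)) = x"
      by (simp add: shift_def)
    with x have "(\<lambda>i. x (i - 1)) \<in> X_of V"
      using subword_Z_shift[of _ "\<lambda>i. x (i - 1)"] by (simp add: X_of_def)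
    with s show "x \<in> shift ` X_of V"
      by (metis imageI)
  qed
  ultimately show ?thesis
    by (simp add: subshift_def)
qed

end

theory Submission
  imports Defs
begin

text \<open>Suppose that \<open>X_of V = X_of W\<close> for a rank-one word \<open>W\<close> with construction \<open>w\<^sub>0, w\<^sub>1, \<dots>\<close>.
  Since \<open>v\<^sub>n\<^sub>,\<^sub>1\<close> appears infinitely often, \<open>V\<close> is recurrent, so its initial segments are subwords
  of \<open>W\<close>. Hence for each \<open>i\<close> there is a decomposition \<open>V = t 1^b w\<^sub>i 1^c w\<^sub>i \<dots>\<close> where \<open>t\<close> is a
  suffix of \<open>w\<^sub>i\<close> starting with \<open>0\<close>. There are finitely many possible \<open>(t, b)\<close> for each \<open>i\<close>, and a
  choice for \<open>i + 1\<close> induces one for \<open>i\<close>, so by Koenig's lemma they can be chosen coherently.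
  As \<open>V\<close> is not rank-one, \<open>w\<^sub>i\<close> is not an initial segment of \<open>V\<close> for large \<open>i\<close>. Then the pairs
  \<open>{t 1^b w\<^sub>i, w\<^sub>i}\<close> form a spacer rank-two construction of \<open>V\<close> whose first word appears only once.\<close>

section \<open>Words spaced by ones\<close>

text \<open>Gaps stand before their blocks, so \<open>u @ spaced u as\<close> is the word built from
  \<open>u\<close> with spacer lengths \<open>as\<close>, and prolonging it means appending to the
  list. Buildings correspond to nonempty lists.\<close>

definition spaced :: "fword \<Rightarrow> nat list \<Rightarrow> fword" where
  "spaced u as = concat (map (\<lambda>a. replicate a 1 @ u) as)"

lemma spaced_Nil [simp]: "spaced u [] = []"
  by (simp add: spaced_def)

lemma spaced_Cons [simp]: "spaced u (a # as) = replicate a 1 @ u @ spaced u as"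
  by (simp add: spaced_def)

lemma spaced_append [simp]: "spaced u (as @ bs) = spaced u as @ spaced u bs"
  by (simp add: spaced_def)

lemma spell_spaced:
  assumes "fst ` set ps \<subseteq> {u}"
  shows "spell ps @ u = u @ spaced u (map snd ps)"
  using assms by (induction ps) auto

lemma built_from_singleton:
  assumes "built_from {u} y"
  obtains as where "as \<noteq> []" "y = u @ spaced u as"
proof -
  from assms obtain b where b: "is_building {u} y b"
    by (auto simp: built_from_def)
  show thesis
  proof (rule that[of "map snd (fst b)"])
    show "map snd (fst b) \<noteq> []"
      using b by (auto simp: is_building_def)
    have "snd b = u" "fst ` set (fst b) \<subseteq> {u}"
      using b by (auto simp: is_building_def building_terms_def)
    then show "y = u @ spaced u (map snd (fst b))"
      using spell_spaced[of "fst b" u] b by (simp add: is_building_def building_word_def)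
  qed
qed

lemma spaced_spaced: "\<exists>cs. spaced (u @ spaced u as) bs = spaced u cs"
proof (induction bs)
  case Nil
  show ?case
    by (rule exI[of _ "[]"]) simp
next
  case (Cons b bs)
  then obtain cs where "spaced (u @ spaced u as) bs = spaced u cs" ..
  then have "spaced (u @ spaced u as) (b # bs) = spaced u (b # as @ cs)"
    by simp
  then show ?case ..
qed

lemma spaced_chain:
  assumes "\<And>i. \<exists>as. w (Suc i) = w i @ spaced (w i) as" "k \<le> m"
  shows "\<exists>as. w m = w k @ spaced (w k) as"
  using assms(2)
proof (induction m rule: dec_induct)
  case base
  show ?case
    by (rule exI[of _ "[]"]) simp
next
  case (step m)
  then obtain as where as: "w m = w k @ spaced (w k) as"
    by blast
  obtain bs where "w (Suc m) = w m @ spaced (w m) bs"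
    using assms(1) by blast
  moreover obtain cs where "spaced (w m) bs = spaced (w k) cs"
    using spaced_spaced as by metis
  ultimately have "w (Suc m) = w k @ spaced (w k) (as @ cs)"
    using as by simp
  then show ?case ..
qed

text \<open>Compare the cut with the first block and the gap after it. Inside the block,
  \<open>t'\<close> can be read off; inside the gap is impossible, as \<open>t\<close> starts with
  0; beyond both, induction applies.\<close>

lemma cut_spaced:
  assumes "u @ spaced u as = c @ t" "t \<noteq> []" "hd t = 0"
  shows "\<exists>c' t' bs. u = c' @ t' \<and> t' \<noteq> [] \<and> hd t' = 0 \<and> t = t' @ spaced u bs"
  using assms(1)
proof (induction as arbitrary: c)
  case Nil
  have "u = c @ t \<and> t \<noteq> [] \<and> hd t = 0 \<and> t = t @ spaced u []"
    using Nil assms by simp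
  then show ?case
    by blast
next
  case (Cons a as)
  consider "length c < length u" | "length u \<le> length c" "length c < length u + a"
    | "length u + a \<le> length c"
    by linarith
  then show ?case
  proof cases
    case 1
    define d where "d = drop (length c) u"
    have "c = take (length c) u"
      using arg_cong[OF Cons.prems, of "take (length c)"] 1 by simp
    then have u: "u = c @ d"
      unfolding d_def by (metis append_take_drop_id)
    moreover have "d \<noteq> []"
      using 1 by (simp add: d_def)
    moreover have "t = d @ spaced u (a # as)"
      using Cons.prems u by auto
    moreover from this \<open>d \<noteq> []\<close> have "hd d = 0"
      using assms(3) by simp
    ultimately show ?thesis
      by blast
  next
    case 2
    have "hd t = (c @ t) ! length c"
      using assms(2) by (simp add: nth_append hd_conv_nth)
    also have "\<dots> = (u @ replicate a 1 @ u @ spaced u as) ! length c"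
      using Cons.prems by simp
    also have "\<dots> = 1"
      using 2 by (simp add: nth_append)
    finally show ?thesis
      using assms(3) by simp
  next
    case 3
    define d where "d = drop (length u + a) c"
    have "u @ spaced u as = drop (length u + a) (u @ spaced u (a # as))"
      by simp
    also have "\<dots> = d @ t"
      using 3 unfolding Cons.prems d_def by simp
    finally show ?thesis
      by (rule Cons.IH)
  qed
qed

text \<open>A 0 closes a gap, a 1 lengthens the trailing run, and that run is empty in the end
  because the word ends in 0. This supplies the passage from the forced level 0 to level 1.\<close>

lemma F_words_spaced_zero:
  assumes "w \<in> F_words" "w \<noteq> [0]"
  shows "\<exists>as. as \<noteq> [] \<and> w = [0] @ spaced [0] as"
proof -
  have *: "\<exists>as b. 0 # x = [0] @ spaced [0] as @ replicate b 1" for x :: fword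
  proof (induction x rule: rev_induct)
    case Nil
    have "0 # [] = [0] @ spaced [0] [] @ replicate 0 1"
      by simp
    then show ?case
      by blast
  next
    case (snoc y x)
    then obtain as b where ab: "0 # x = [0] @ spaced [0] as @ replicate b 1"
      by blast
    show ?case
    proof (cases y)
      case zero
      then have "0 # x @ [y] = [0] @ spaced [0] (as @ [b]) @ replicate 0 1"
        using ab by simp
      then show ?thesis
        by blast
    next
      case one
      then have "0 # x @ [y] = [0] @ spaced [0] as @ replicate (Suc b) 1"
        using ab by (simp add: replicate_append_same)
      then show ?thesis
        by blast
    qed
  qed
  obtain x where "w = 0 # x"
    using assms(1) by (cases w) (auto simp: F_words_def)
  with * obtain as b where w: "w = [0] @ spaced [0] as @ replicate b 1"
    by metis
  have "b = 0"
  proof (rule ccontr)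
    assume "b \<noteq> 0"
    then have "last w = 1"
      using w by (simp add: last_append)
    then show False
      using assms(1) by (simp add: F_words_def)
  qed
  then show ?thesis
    using w assms(2) by (cases as) auto
qed

section \<open>Initial segments and recurrence\<close>

lemma initial_segment_nth:
  "initial_segment w V \<longleftrightarrow> (\<forall>i<length w. w ! i = V i)"
  unfolding initial_segment_def by (subst list_eq_iff_nth_eq) simp

lemma initial_segment_take:
  assumes "initial_segment w V" "n \<le> length w"
  shows "map V [0..<n] = take n w"
proof -
  have "take n w = take n (map V [0..<length w])"
    using assms(1) by (simp add: initial_segment_def)
  then show ?thesis
    using assms(2) by (simp add: take_map)
qed

definition recurrent :: "iword \<Rightarrow> bool" where
  "recurrent V \<longleftrightarrow> (\<forall>l m. \<exists>r\<ge>m. \<forall>j<l. V (r + j) = V j)"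

lemma length_spell:
  assumes "\<And>p. p \<in> set ps \<Longrightarrow> fst p \<noteq> []"
  shows "length ps \<le> length (spell ps)"
  using assms
proof (induction ps)
  case (Cons p ps)
  have "0 < length (fst p)"
    using Cons.prems[of p] by simp
  moreover have "length ps \<le> length (spell ps)"
    using Cons by simp
  ultimately show ?case
    unfolding spell_Cons length_append list.size by linarith
qed simp

lemma construction_buildings_exist:
  assumes "spacer_rank_two_construction V v1 v2"
  shows "\<exists>B. construction_buildings v1 v2 B"
proof -
  have "\<exists>b. is_building (level v1 v2 n) (v1 (Suc n)) b \<and> starts_with (v1 n) b"
    and "\<exists>b. is_building (level v1 v2 n) (v2 (Suc n)) b" for n
    using assms
    by (auto simp: spacer_rank_two_construction_def built_from_def built_from_starting_def)
  then obtain f g where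
    "\<And>n. is_building (level v1 v2 n) (v1 (Suc n)) (f n) \<and> starts_with (v1 n) (f n)"
    "\<And>n. is_building (level v1 v2 n) (v2 (Suc n)) (g n)"
    by metis
  \<comment> \<open>The test for \<open>v1 (Suc n)\<close> comes first: if the two words coincide,
    the shared building must be the one starting with \<open>v1 n\<close>.\<close>
  then have "construction_buildings v1 v2 (\<lambda>n w. if w = v1 (Suc n) then f n else g n)"
    by (auto simp: construction_buildings_def)
  then show ?thesis
    by blast
qed

lemma length_first_word:
  assumes "spacer_rank_two_construction V v1 v2"
  shows "n \<le> length (v1 n)"
proof (induction n)
  case (Suc n)
  obtain b where b: "is_building (level v1 v2 n) (v1 (Suc n)) b" "starts_with (v1 n) b"
    using assms unfolding spacer_rank_two_construction_def built_from_starting_def by blast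
  then obtain p ps where p: "fst b = p # ps"
    by (cases "fst b") (auto simp: is_building_def)
  with b have "fst p = v1 n"
    by (simp add: starts_with_def building_terms_def)
  moreover have "snd b \<in> F_words"
    using b(1) assms by (auto simp: is_building_def building_terms_def
        spacer_rank_two_construction_def)
  then have "0 < length (snd b)"
    by (auto simp: F_words_def)
  moreover have "v1 (Suc n) = spell (fst b) @ snd b"
    using b(1) by (simp add: is_building_def building_word_def)
  ultimately show ?case
    using p Suc by (simp del: length_greater_0_conv)
qed simp

text \<open>An appearance of \<open>v1 l\<close> with index at least \<open>m\<close> is preceded by
  at least \<open>m\<close> nonempty terms, hence starts at position \<open>m\<close> or later.
  Having length at least \<open>l\<close>, it repeats the first \<open>l\<close> letters of
  \<open>V\<close>.\<close>

lemma recurrent_if_first_word_appears: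
  assumes c: "spacer_rank_two_construction V v1 v2"
    and B: "construction_buildings v1 v2 B"
    and inf: "\<And>n. first_word_appears_infinitely_often v1 B n"
  shows "recurrent V"
  unfolding recurrent_def
proof (intro allI)
  fix l m
  let ?e = "expected_building v1 B l"
  obtain i where i: "i \<ge> m" "fst (?e i) = v1 l"
    using inf[of l] by (auto simp: first_word_appears_infinitely_often_def infinite_nat_iff_unbounded_le)
  have e: "is_infinite_building (level v1 v2 l) V ?e"
    by (rule expected_building_is_infinite_building[OF c B])
  let ?s = "spell (map ?e [0..<i])"
  have "fst (?e k) \<noteq> []" for k
    using e c by (force simp: is_infinite_building_def spacer_rank_two_construction_def F_words_def)
  then have "length (map ?e [0..<i]) \<le> length ?s"
    by (intro length_spell) auto
  then have s: "m \<le> length ?s"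
    using i by simp
  have "initial_segment (spell (map ?e [0..<Suc i])) V"
    using e by (simp only: is_infinite_building_def)
  then have "initial_segment ((?s @ v1 l) @ replicate (snd (?e i)) 1) V"
    using i by simp
  then have sv: "initial_segment (?s @ v1 l) V"
    by (rule initial_segment_append)
  have v: "initial_segment (v1 l) V"
    using c by (simp add: spacer_rank_two_construction_def)
  have "V (length ?s + j) = V j" if "j < l" for j
  proof -
    have j: "j < length (v1 l)"
      using length_first_word[OF c, of l] that by linarith
    then have "(?s @ v1 l) ! (length ?s + j) = V (length ?s + j)"
      using sv unfolding initial_segment_nth by (metis length_append nat_add_left_cancel_less)
    moreover have "v1 l ! j = V j"
      using v j by (simp add: initial_segment_nth)
    ultimately show ?thesis
      by simp
  qed
  with s show "\<exists>r\<ge>m. \<forall>j<l. V (r + j) = V j"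
    by blast
qed

section \<open>Two-sided points obtained from a recurrent word\<close>

text \<open>The point \<open>x\<close> is the union of nested occurrences of the initial segments of \<open>V\<close> of
  length \<open>L k\<close>, the \<open>k\<close>-th one placed at position \<open>- S k\<close>.\<close>

lemma recurrent_extends_to_X_of:
  assumes "recurrent V"
  shows "\<exists>x\<in>X_of V. \<forall>j<l. x (int j) = V j"
proof -
  have "\<forall>l. \<exists>r\<ge>1. \<forall>j<l. V (r + j) = V j"
    using assms unfolding recurrent_def by blast
  then obtain r where r: "\<And>l. 1 \<le> r l" "\<And>l j. j < l \<Longrightarrow> V (r l + j) = V j"
    unfolding choice_iff by blast
  \<comment> \<open>The added 1 makes the windows grow to the right as well: by \<open>LS\<close>
    the \<open>k\<close>-th one occupies the positions from \<open>- S k\<close> to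
    \<open>k + l\<close>.\<close>
  define L where "L = rec_nat (Suc l) (\<lambda>_ n. r n + n + 1)"
  have L: "L 0 = Suc l" "L (Suc k) = r (L k) + L k + 1" for k
    by (simp_all add: L_def)
  define S where "S = rec_nat 0 (\<lambda>k s. s + r (L k))"
  have S: "S 0 = 0" "S (Suc k) = S k + r (L k)" for k
    by (simp_all add: S_def)
  have LS: "L k = S k + k + Suc l" for k
    by (induction k) (simp_all add: L S)
  have Sk: "k \<le> S k" for k
  proof (induction k)
    case (Suc k)
    then show ?case
      using r(1)[of "L k"] by (simp add: S)
  qed simp
  have shift: "V (nat (i + int (S (Suc k)))) = V (nat (i + int (S k)))"
    if "0 \<le> i + int (S k)" "i + int (S k) < int (L k)" for i k
  proof -
    have "nat (i + int (S (Suc k))) = r (L k) + nat (i + int (S k))"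
      using that by (simp add: S)
    then show ?thesis
      using r(2)[of "nat (i + int (S k))" "L k"] that by simp
  qed
  have stable: "V (nat (i + int (S m))) = V (nat (i + int (S k)))"
    if "k \<le> m" "0 \<le> i + int (S k)" "i \<le> int k + int l" for i k m
    using that(1)
  proof (induction m rule: dec_induct)
    case (step m)
    have "S k \<le> S m"
      by (rule lift_Suc_mono_le[OF _ step(1)]) (simp add: S)
    then have "0 \<le> i + int (S m)" "i + int (S m) < int (L m)"
      using that step(1) LS[of m] by linarith+
    then show ?case
      using shift[of i m] step by simp
  qed simp
  define x where "x i = V (nat (i + int (S (nat \<bar>i\<bar>))))" for i
  have x: "x i = V (nat (i + int (S k)))" if "\<bar>i\<bar> \<le> int k" for i k
    unfolding x_def
    by (rule stable[symmetric]) (use that Sk[of "nat \<bar>i\<bar>"] in linarith)+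
  have "x \<in> X_of V"
    unfolding X_of_def
  proof (intro CollectI allI impI)
    fix w assume "subword_Z w x"
    then obtain i where w: "w = map (\<lambda>j. x (i + int j)) [0..<length w]"
      by (auto simp: subword_Z_def)
    define k where "k = nat \<bar>i\<bar> + length w"
    have "x (i + int j) = V (nat (i + int (S k)) + j)" if "j < length w" for j
    proof -
      have "\<bar>i + int j\<bar> \<le> int k"
        using that by (simp add: k_def)
      then have "x (i + int j) = V (nat (i + int j + int (S k)))"
        by (rule x)
      moreover have "0 \<le> i + int (S k)"
        using Sk[of k] unfolding k_def by linarith
      then have "nat (i + int j + int (S k)) = nat (i + int (S k)) + j"
        by linarith
      ultimately show ?thesis
        by simp
    qed
    then have "w = map (\<lambda>j. V (nat (i + int (S k)) + j)) [0..<length w]"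
      by (subst w) simp
    then show "subword w V"
      unfolding subword_def by blast
  qed
  moreover have "x (int j) = V j" if "j < l" for j
    using x[of "int j" j] stable[of 0 j "int j"] that by (simp add: S)
  ultimately show ?thesis
    by blast
qed

text \<open>\<open>X_of V\<close> only controls words with two-sided continuations; recurrence
  places the prefix in such a point.\<close>

lemma recurrent_subword:
  assumes "recurrent V" "X_of V \<subseteq> X_of W"
  shows "subword (map V [0..<l]) W"
proof -
  obtain x where x: "x \<in> X_of V" "\<And>j. j < l \<Longrightarrow> x (int j) = V j"
    using recurrent_extends_to_X_of[OF assms(1)] by blast
  have "subword_Z (map V [0..<l]) x"
    unfolding subword_Z_def by (rule exI[of _ 0]) (simp add: x)
  then show ?thesis
    using x(1) assms(2) by (auto simp: X_of_def)
qed

section \<open>Coherent decompositions\<close>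

text \<open>The dependent choice keeps an extra invariant: for infinitely many \<open>d\<close>, the
  node \<open>s (k + d)\<close> has the chosen node as its ancestor at level \<open>k\<close>. The
  pigeonhole principle passes this on to the next level.\<close>

lemma konig:
  fixes G :: "nat \<Rightarrow> 'a \<Rightarrow> bool"
  assumes fin: "\<And>k. finite {p. G k p}"
    and ne: "\<And>k. \<exists>p. G k p"
    and parent: "\<And>k p. G (Suc k) p \<Longrightarrow> \<exists>q. G k q \<and> R k q p"
  shows "\<exists>f. \<forall>k. G k (f k) \<and> R k (f k) (f (Suc k))"
proof -
  obtain \<pi> where \<pi>: "\<And>k p. G (Suc k) p \<Longrightarrow> G k (\<pi> k p) \<and> R k (\<pi> k p) p"
    using parent by metis
  obtain s where s: "\<And>n. G n (s n)"
    using ne by metis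
  \<comment> \<open>\<open>anc d k p\<close> is the ancestor at level \<open>k\<close> of a node
    \<open>p\<close> at level \<open>k + d\<close>.\<close>
  define anc where "anc = rec_nat (\<lambda>k p. p) (\<lambda>d f k p. \<pi> k (f (Suc k) p))"
  have anc: "anc 0 k p = p" "anc (Suc d) k p = \<pi> k (anc d (Suc k) p)" for d k p
    by (simp_all add: anc_def)
  have G_anc: "G k (anc d k p)" if "G (k + d) p" for d k p
    using that by (induction d arbitrary: k) (auto simp: anc \<pi>)
  let ?N = "\<lambda>k q. {d. anc d k (s (k + d)) = q}"
  have pigeon: "\<exists>p. G k p \<and> infinite {d \<in> A. anc d k (s (k + d)) = p}" if "infinite A" for A k
  proof -
    have "(\<lambda>d. anc d k (s (k + d))) ` A \<subseteq> {p. G k p}"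
      using G_anc s by blast
    then have "finite ((\<lambda>d. anc d k (s (k + d))) ` A)"
      using fin by (rule finite_subset)
    from pigeonhole_infinite[OF that this] obtain a
      where "a \<in> A" "infinite {d \<in> A. anc d k (s (k + d)) = anc a k (s (k + a))}"
      by blast
    then show ?thesis
      using G_anc s by blast
  qed
  have "\<exists>f. \<forall>k. (G k (f k) \<and> infinite (?N k (f k))) \<and> R k (f k) (f (Suc k))"
  proof (rule dependent_nat_choice)
    show "\<exists>p. G 0 p \<and> infinite (?N 0 p)"
      using pigeon[of UNIV 0] by simp
  next
    fix q k assume q: "G k q \<and> infinite (?N k q)"
    \<comment> \<open>The index \<open>d = 0\<close> is dropped, since a node at level
      \<open>k\<close> has no ancestor at level \<open>Suc k\<close>; the others are shifted by
      one.\<close>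
    have "?N k q \<subseteq> insert 0 (Suc ` {d. anc (Suc d) k (s (k + Suc d)) = q})"
    proof
      fix d assume "d \<in> ?N k q"
      then show "d \<in> insert 0 (Suc ` {d. anc (Suc d) k (s (k + Suc d)) = q})"
        by (cases d) auto
    qed
    then have "infinite {d. anc (Suc d) k (s (k + Suc d)) = q}"
      using q by (meson finite_imageI finite_insert finite_subset)
    from pigeon[OF this, of "Suc k"] obtain p where p: "G (Suc k) p"
      and inf: "infinite {d \<in> {d. anc (Suc d) k (s (k + Suc d)) = q}.
        anc d (Suc k) (s (Suc k + d)) = p}"
      by blast
    from infinite_imp_nonempty[OF inf] obtain d where
      "anc (Suc d) k (s (k + Suc d)) = q" "anc d (Suc k) (s (Suc k + d)) = p"
      by blast
    then have "q = \<pi> k p"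
      by (simp add: anc)
    moreover have "infinite (?N (Suc k) p)"
      by (rule infinite_super[OF _ inf]) auto
    ultimately show "\<exists>p. (G (Suc k) p \<and> infinite (?N (Suc k) p)) \<and> R k q p"
      using p \<pi>[OF p] by blast
  qed
  then show ?thesis
    by blast
qed

text \<open>Only the length \<open>p\<close> of \<open>t 1^b\<close> is recorded, since
  \<open>V\<close> determines its letters. Only one full copy of \<open>u\<close> is demanded after
  it; further copies come from the coherent choice.\<close>

definition decomposition :: "iword \<Rightarrow> fword \<Rightarrow> nat \<Rightarrow> bool" where
  "decomposition V u p \<longleftrightarrow>
     (\<exists>c t b. u = c @ t \<and> t \<noteq> [] \<and> hd t = 0 \<and> map V [0..<p] = t @ replicate b 1) \<and>
     initial_segment (map V [0..<p] @ u) V"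

lemma decompositionI:
  assumes "u = c @ t" "t \<noteq> []" "hd t = 0" "initial_segment (t @ replicate b 1 @ u) V"
  shows "decomposition V u (length t + b)" "map V [0..<length t + b] = t @ replicate b 1"
proof -
  show "map V [0..<length t + b] = t @ replicate b 1"
    using initial_segment_take[OF assms(4), of "length t + b"] by simp
  with assms show "decomposition V u (length t + b)"
    by (auto simp: decomposition_def)
qed

text \<open>As \<open>t\<close> is a suffix of \<open>u\<close>, the prefix of length
  \<open>p\<close> has only ones from position \<open>length u\<close> on, so it cannot contain the
  zero at \<open>m\<close>.\<close>

lemma decomposition_bounded:
  assumes "decomposition V u p" "V m = 0" "length u \<le> m"
  shows "p \<le> m"
proof (rule ccontr)
  assume m: "\<not> p \<le> m"
  obtain c t b where u: "u = c @ t" "map V [0..<p] = t @ replicate b 1"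
    using assms(1) by (auto simp: decomposition_def)
  have p: "p = length t + b"
    using arg_cong[OF u(2), of length] by simp
  have "V m = map V [0..<p] ! m"
    using m by simp
  also have "\<dots> = 1"
    unfolding u(2) using m p assms(3) u(1) by (simp add: nth_append)
  finally show False
    using assms(2) by simp
qed

lemma decomposition_spaced:
  assumes "decomposition V (u @ spaced u as) p" "as \<noteq> []"
  shows "\<exists>q. decomposition V u q \<and>
    (\<exists>bs. bs \<noteq> [] \<and> map V [0..<p] @ u @ spaced u as = map V [0..<q] @ u @ spaced u bs)"
proof -
  obtain c t b where t: "u @ spaced u as = c @ t" "t \<noteq> []" "hd t = 0"
    "map V [0..<p] = t @ replicate b 1"
    and init: "initial_segment (map V [0..<p] @ u @ spaced u as) V"
    using assms(1) by (auto simp: decomposition_def)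
  obtain c' t' ds where t': "u = c' @ t'" "t' \<noteq> []" "hd t' = 0" "t = t' @ spaced u ds"
    using cut_spaced[OF t(1-3)] by blast
  \<comment> \<open>The gap after the partial block \<open>t'\<close> is the first entry of
    \<open>ds\<close>, or \<open>b\<close> if \<open>ds\<close> is empty. A further gap remains in
    both cases, in the latter because \<open>as\<close> is nonempty.\<close>
  obtain a bs where ab: "ds @ b # as = a # bs" "bs \<noteq> []"
    using assms(2) by (cases ds) auto
  have "map V [0..<p] @ u @ spaced u as = t' @ spaced u (ds @ b # as)"
    by (simp add: t t')
  also have "\<dots> = t' @ replicate a 1 @ u @ spaced u bs"
    by (simp only: ab spaced_Cons)
  finally have eq: "map V [0..<p] @ u @ spaced u as = t' @ replicate a 1 @ u @ spaced u bs" .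
  then have "initial_segment (t' @ replicate a 1 @ u) V"
    using init initial_segment_append[of "t' @ replicate a 1 @ u"] by simp
  from decompositionI[OF t'(1-3) this] eq ab(2) show ?thesis
    by (metis append.assoc)
qed

text \<open>The zero at \<open>m\<close> ends the run of ones after the partial block, so the first
  full copy of \<open>u\<close> starts no later than \<open>m\<close> and lies within the prefix of
  length \<open>m + length u + 1\<close>.\<close>

lemma decomposition_exists:
  assumes V: "V 0 = 0" "V m = 0" "length u \<le> m" "u \<noteq> []"
    and y: "u @ spaced u as = c @ map V [0..<m + length u + 1] @ d"
  shows "\<exists>p. decomposition V u p"
proof -
  let ?v = "map V [0..<m + length u + 1]"
  have "?v @ d \<noteq> []" "hd (?v @ d) = 0"
    using V(1) by (auto simp: hd_append hd_map upt_conv_Cons simp del: upt_Suc)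
  from cut_spaced[OF y this] obtain c' t bs where
    t: "u = c' @ t" "t \<noteq> []" "hd t = 0" "?v @ d = t @ spaced u bs"
    by blast
  obtain b bs' where b: "bs = b # bs'"
    using arg_cong[OF t(4), of length] t(1) V(3) by (cases bs) auto
  have v: "?v @ d = (t @ replicate b 1 @ u) @ spaced u bs'"
    using t(4) b by simp
  have "length t + b \<le> m"
  proof (rule ccontr)
    assume "\<not> length t + b \<le> m"
    moreover have "(?v @ d) ! m = V m"
      by (simp add: nth_append del: upt_Suc)
    moreover have "length t \<le> m"
      using t(1) V(3) by simp
    ultimately have "V m = 1"
      unfolding v by (simp add: nth_append split: if_splits)
    then show False
      using V(2) by simp
  qed
  then have "t @ replicate b 1 @ u = take (length (t @ replicate b 1 @ u)) ?v"
    using arg_cong[OF v, of "take (length (t @ replicate b 1 @ u))"] by simp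
  also have "\<dots> = map V [0..<length (t @ replicate b 1 @ u)]"
    using \<open>length t + b \<le> m\<close> by (simp add: take_map del: upt_Suc)
  finally have "initial_segment (t @ replicate b 1 @ u) V"
    by (simp add: initial_segment_def)
  with t(1-3) show ?thesis
    using decompositionI(1) by blast
qed

section \<open>A construction whose first word appears once\<close>

text \<open>The first term may differ from the repeated one, so both words of a level are covered.
  Buildings put each gap after its term, hence the split into \<open>hd\<close> and
  \<open>tl\<close>.\<close>

definition spaced_building :: "fword \<Rightarrow> fword \<Rightarrow> nat list \<Rightarrow> building" where
  "spaced_building x u as = ((x, hd as) # map (Pair u) (tl as), u)"

lemma spell_map_Pair: "spell (map (Pair u) as) @ u = u @ spaced u as"
  by (induction as) auto

lemma spaced_building:
  assumes "as \<noteq> []" "y = x @ spaced u as"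
  shows "building_terms (spaced_building x u as) = x # replicate (length as) u"
    and "is_building {x, u} y (spaced_building x u as)"
    and "starts_with x (spaced_building x u as)"
proof -
  obtain a bs where as: "as = a # bs"
    using assms(1) by (cases as) auto
  show 1: "building_terms (spaced_building x u as) = x # replicate (length as) u"
    by (simp add: as spaced_building_def building_terms_def comp_def map_replicate_const
        replicate_append_same)
  show "is_building {x, u} y (spaced_building x u as)"
    unfolding is_building_def 1
    by (auto simp: as assms(2) spaced_building_def building_word_def spell_map_Pair)
  show "starts_with x (spaced_building x u as)"
    by (simp add: starts_with_def 1)
qed

lemma building_terms_subst_building:
  "building_terms (subst_building \<beta> b) = concat (map (building_terms \<circ> \<beta>) (building_terms b))"
proof -
  have "map fst (subst_pairs \<beta> ps) = concat (map (building_terms \<circ> \<beta>) (map fst ps))" for ps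
    by (induction ps) (auto simp: building_terms_def)
  then show ?thesis
    by (simp add: building_terms_def subst_building_def)
qed

text \<open>Level \<open>Suc n\<close> is \<open>{x n, u n}\<close>. The composed building of
  \<open>x k\<close> from level 1 is \<open>x 0\<close> followed by copies of \<open>u 0\<close>
  only, and these words differ. Level 0 could not serve, as its two words coincide.\<close>

lemma first_word_appears_once:
  fixes x u :: "nat \<Rightarrow> fword"
  assumes V: "\<not> rank_one_word V" "\<And>n. initial_segment (x n) V"
    and F: "\<And>n. x n \<in> F_words" "\<And>n. u n \<in> F_words"
    and ne: "\<And>n. x n \<noteq> u n" "x 0 \<noteq> [0]" "u 0 \<noteq> [0]"
    and x: "\<And>n. \<exists>as. as \<noteq> [] \<and> x (Suc n) = x n @ spaced (u n) as"
    and u: "\<And>n. \<exists>as. as \<noteq> [] \<and> u (Suc n) = u n @ spaced (u n) as"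
  shows "\<exists>v1 v2 B. spacer_rank_two_construction V v1 v2 \<and> construction_buildings v1 v2 B \<and>
    \<not> first_word_appears_infinitely_often v1 B 1"
proof -
  define v1 v2 where "v1 = case_nat [0] x" and "v2 = case_nat [0] u"
  have v [simp]: "v1 0 = [0]" "v2 0 = [0]" "\<And>n. v1 (Suc n) = x n" "\<And>n. v2 (Suc n) = u n"
    by (simp_all add: v1_def v2_def)
  obtain ax au where ax: "ax \<noteq> []" "x 0 = [0] @ spaced [0] ax"
    and au: "au \<noteq> []" "u 0 = [0] @ spaced [0] au"
    using F_words_spaced_zero F ne by metis
  obtain fx fu where fx: "\<And>n. fx n \<noteq> []" "\<And>n. x (Suc n) = x n @ spaced (u n) (fx n)"
    and fu: "\<And>n. fu n \<noteq> []" "\<And>n. u (Suc n) = u n @ spaced (u n) (fu n)"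
    using x u by metis
  \<comment> \<open>Selecting a building by comparing words is unambiguous because
    \<open>x n\<close> and \<open>u n\<close> differ.\<close>
  define B where "B = case_nat
    (\<lambda>w. spaced_building [0] [0] (if w = x 0 then ax else au))
    (\<lambda>n w. if w = x (Suc n) then spaced_building (x n) (u n) (fx n)
           else spaced_building (u n) (u n) (fu n))"
  have B [simp]: "B 0 (x 0) = spaced_building [0] [0] ax" "B 0 (u 0) = spaced_building [0] [0] au"
    "B (Suc n) (x (Suc n)) = spaced_building (x n) (u n) (fx n)"
    "B (Suc n) (u (Suc n)) = spaced_building (u n) (u n) (fu n)" for n
    using ne(1)[of 0] ne(1)[of "Suc n"] by (auto simp: B_def)
  have mono: "is_building (insert w S) y b" if "is_building S y b" for S y b w
    using that by (auto simp: is_building_def)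
  have b: "is_building (level v1 v2 n) (v1 (Suc n)) (B n (v1 (Suc n))) \<and>
    starts_with (v1 n) (B n (v1 (Suc n))) \<and>
    is_building (level v1 v2 n) (v2 (Suc n)) (B n (v2 (Suc n)))" for n
  proof (cases n)
    case 0
    then show ?thesis
      using spaced_building(2,3)[OF ax] spaced_building(2)[OF au] by (simp add: level_def)
  next
    case (Suc k)
    then show ?thesis
      using spaced_building(2,3)[OF fx(1) fx(2), of k] mono[OF spaced_building(2)[OF fu(1) fu(2), of k]]
      by (simp add: level_def)
  qed
  then have B_ok: "construction_buildings v1 v2 B"
    by (simp add: construction_buildings_def)
  have "[0] \<in> F_words"
    by (simp add: F_words_def)
  then have "level v1 v2 n \<subseteq> F_words" for n
    using F by (cases n) (auto simp: level_def)
  moreover have "initial_segment (v1 n) V" for n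
  proof (cases n)
    case 0
    have "x 0 \<noteq> []" "hd (x 0) = 0"
      using F(1)[of 0] by (auto simp: F_words_def)
    then show ?thesis
      using V(2)[of 0] 0 by (auto simp: initial_segment_nth hd_conv_nth)
  qed (simp add: V)
  ultimately have c: "spacer_rank_two_construction V v1 v2"
    using b V(1) unfolding spacer_rank_two_construction_def built_from_def built_from_starting_def
    by (intro conjI allI) (blast | simp)+
  have terms_u: "set (building_terms (composed B 1 k (u k))) \<subseteq> {u 0}" for k
  proof (induction k)
    case 0
    show ?case
      by (simp add: building_terms_def)
  next
    case (Suc k)
    then show ?case
      by (auto simp: building_terms_subst_building spaced_building(1)[OF fu])
  qed
  have terms_x: "\<exists>ts. building_terms (composed B 1 k (x k)) = x 0 # ts \<and> set ts \<subseteq> {u 0}" for k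
  proof (induction k)
    case 0
    show ?case
      by (simp add: building_terms_def)
  next
    case (Suc k)
    then obtain ts where ts: "building_terms (composed B 1 k (x k)) = x 0 # ts" "set ts \<subseteq> {u 0}"
      by blast
    let ?us = "concat (replicate (length (fx k)) (building_terms (composed B 1 k (u k))))"
    have "building_terms (composed B 1 (Suc k) (x (Suc k))) = x 0 # ts @ ?us"
      using ts(1) by (simp add: building_terms_subst_building spaced_building(1)[OF fx])
    moreover have "set (ts @ ?us) \<subseteq> {u 0}"
      using terms_u[of k] ts(2) unfolding set_append set_concat by fastforce
    ultimately show ?case
      by blast
  qed
  have "fst (expected_building v1 B 1 i) \<noteq> v1 1" if "i \<noteq> 0" for i
  proof -
    let ?ps = "fst (composed B 1 (Suc i) (x (Suc i)))"
    obtain ts where ts: "building_terms (composed B 1 (Suc i) (x (Suc i))) = x 0 # ts"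
      "set ts \<subseteq> {u 0}"
      using terms_x by blast
    have i: "i < length ?ps"
      using length_composed[OF B_ok, of "Suc i" 1] by (simp del: composed.simps)
    have "length ?ps = length ts"
      using arg_cong[OF ts(1), of length] by (simp add: building_terms_def del: composed.simps)
    have "fst (?ps ! i) = building_terms (composed B 1 (Suc i) (x (Suc i))) ! i"
      using i by (simp add: building_terms_def nth_append del: composed.simps)
    also have "\<dots> = ts ! (i - 1)"
      unfolding ts using that by (simp add: nth_Cons')
    also have "\<dots> \<in> set ts"
      using i \<open>length ?ps = length ts\<close> by simp
    finally show ?thesis
      using ts(2) ne(1)[of 0] by (auto simp: expected_building_def simp del: composed.simps)
  qed
  then have "{i. fst (expected_building v1 B 1 i) = v1 1} \<subseteq> {0}"
    by blast
  then have "\<not> first_word_appears_infinitely_often v1 B 1"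
    unfolding first_word_appears_infinitely_often_def using finite_subset by blast
  with c B_ok show ?thesis
    by blast
qed

section \<open>From a rank-one word with a larger subshift to the construction\<close>

lemma rank_one_subshift_construction:
  assumes V: "\<not> rank_one_word V" "recurrent V" "V 0 = 0"
    and W: "rank_one_word W" "X_of V \<subseteq> X_of W"
  shows "\<exists>v1 v2 B. spacer_rank_two_construction V v1 v2 \<and> construction_buildings v1 v2 B \<and>
    \<not> first_word_appears_infinitely_often v1 B 1"
proof -
  obtain w where w: "\<And>i. w i \<in> F_words" "w 0 = [0]" "\<And>i. built_from {w i} (w (Suc i))"
    "\<And>i. initial_segment (w i) W"
    using W(1) by (auto simp: rank_one_word_def)
  have ne: "w i \<noteq> []" "hd (w i) = 0" "last (w i) = 0" for i
    using w(1) by (auto simp: F_words_def)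
  have step: "\<exists>as. as \<noteq> [] \<and> w (Suc i) = w i @ spaced (w i) as" for i
    using built_from_singleton[OF w(3)] by metis
  have chain: "\<exists>as. w m = w k @ spaced (w k) as" if "k \<le> m" for k m
  proof (rule spaced_chain[OF _ that])
    show "\<exists>as. w (Suc i) = w i @ spaced (w i) as" for i
      using step[of i] by blast
  qed
  have len: "i < length (w i)" for i
  proof (induction i)
    case (Suc i)
    obtain as where "as \<noteq> []" "w (Suc i) = w i @ spaced (w i) as"
      using step by blast
    then show ?case
      using Suc ne(1)[of i] by (cases as) auto
  qed (simp add: w)
  have zero: "\<exists>m\<ge>l. V m = 0" for l
  proof -
    obtain r where "r \<ge> l" "\<forall>j<1. V (r + j) = V j"
      using V(2) unfolding recurrent_def by blast
    then show ?thesis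
      using V(3) by auto
  qed
  \<comment> \<open>A long prefix of \<open>V\<close> is a subword of \<open>W\<close>, hence of
    some \<open>w n\<close> with \<open>n \<ge> k\<close>, which consists of spaced copies of
    \<open>w k\<close>.\<close>
  have exists: "\<exists>p. decomposition V (w k) p" for k
  proof -
    obtain m where m: "m \<ge> length (w k)" "V m = 0"
      using zero by blast
    define l where "l = m + length (w k) + 1"
    obtain i where i: "map V [0..<l] = map (\<lambda>j. W (i + j)) [0..<l]"
      using recurrent_subword[OF V(2) W(2), of l] by (auto simp: subword_def)
    define n where "n = k + i + l"
    have n: "i + l \<le> length (w n)"
      using len[of n] by (simp add: n_def)
    have "take l (drop i (w n)) = map V [0..<l]"
      unfolding i using n w(4)[of n] by (intro nth_equalityI) (auto simp: initial_segment_nth)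
    then have "w n = take i (w n) @ map V [0..<l] @ drop l (drop i (w n))"
      by (metis append_take_drop_id)
    moreover obtain as where "w n = w k @ spaced (w k) as"
      using chain[of k n] by (auto simp: n_def)
    ultimately show ?thesis
      using decomposition_exists[OF V(3) m(2,1) ne(1)] unfolding l_def by metis
  qed
  \<comment> \<open>Otherwise \<open>w\<close> would be a rank-one construction of \<open>V\<close>.
    Later words inherit the failure from their prefix \<open>w i0\<close>, which keeps the two words
    of each level distinct.\<close>
  obtain i0 where i0: "\<not> initial_segment (w i0) V"
    using V(1) w unfolding rank_one_word_def by blast
  define u where "u i = w (i0 + i)" for i
  have not_init: "\<not> initial_segment (u i) V" for i
    using i0 chain[of i0 "i0 + i"] initial_segment_append unfolding u_def by force
  have u_step: "\<exists>as. as \<noteq> [] \<and> u (Suc i) = u i @ spaced (u i) as" for i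
    using step[of "i0 + i"] by (simp add: u_def)
  \<comment> \<open>For the words \<open>x k\<close> defined below, this says that
    \<open>x (Suc k)\<close> prolongs \<open>x k\<close> by at least one spaced copy of
    \<open>u k\<close>.\<close>
  let ?R = "\<lambda>k q p. \<exists>as. as \<noteq> [] \<and>
    map V [0..<p] @ u (Suc k) = map V [0..<q] @ u k @ spaced (u k) as"
  have "\<exists>f. \<forall>k. decomposition V (u k) (f k) \<and> ?R k (f k) (f (Suc k))"
  proof (rule konig)
    fix k
    obtain m where "m \<ge> length (u k)" "V m = 0"
      using zero by blast
    then have "{p. decomposition V (u k) p} \<subseteq> {..m}"
      using decomposition_bounded by auto
    then show "finite {p. decomposition V (u k) p}"
      by (rule finite_subset) simp
    show "\<exists>p. decomposition V (u k) p"
      unfolding u_def by (rule exists)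
    fix p assume "decomposition V (u (Suc k)) p"
    then show "\<exists>q. decomposition V (u k) q \<and> ?R k q p"
      using u_step[of k] decomposition_spaced by metis
  qed
  then obtain f where f: "\<And>k. decomposition V (u k) (f k)" "\<And>k. ?R k (f k) (f (Suc k))"
    by blast
  define x where "x k = map V [0..<f k] @ u k" for k
  have x_init: "initial_segment (x k) V" for k
    using f(1)[of k] by (simp add: x_def decomposition_def)
  have x_ne: "x k \<noteq> u k" for k
    using x_init not_init by metis
  have u0: "[0] \<noteq> u k" for k
  proof -
    have "initial_segment [0] V"
      using V(3) by (simp add: initial_segment_def)
    then show ?thesis
      using not_init[of k] by metis
  qed
  show ?thesis
  proof (rule first_word_appears_once[of V x u])
    show "x n \<in> F_words" for n
    proof -
      have "x n \<noteq> []" "last (x n) = 0"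
        using ne[of "i0 + n"] by (auto simp: x_def u_def)
      then show ?thesis
        using x_init[of n] V(3) by (auto simp: F_words_def initial_segment_nth hd_conv_nth)
    qed
    show "u n \<in> F_words" for n
      by (simp add: u_def w)
    show "\<exists>as. as \<noteq> [] \<and> x (Suc n) = x n @ spaced (u n) as" for n
      using f(2)[of n] by (simp add: x_def)
    show "x 0 \<noteq> [0]"
      using x_ne[of 0] ne(1)[of i0] by (auto simp: x_def u_def append_eq_Cons_conv)
    show "u 0 \<noteq> [0]"
      using u0 by metis
  qed (use V(1) x_init x_ne u_step in auto)
qed

theorem theorem6p11:
  fixes V :: "nat \<Rightarrow> bit"
  assumes "spacer_rank_two_word V"
    and "\<And>v1 v2 B n. spacer_rank_two_construction V v1 v2 \<Longrightarrow> construction_buildings v1 v2 B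
           \<Longrightarrow> first_word_appears_infinitely_often v1 B n"
  shows "spacer_rank_two_system (X_of V)"
proof -
  obtain v1 v2 where c: "spacer_rank_two_construction V v1 v2"
    using assms(1) by (auto simp: spacer_rank_two_word_def)
  obtain B where B: "construction_buildings v1 v2 B"
    using construction_buildings_exist[OF c] ..
  have rec: "recurrent V"
    using recurrent_if_first_word_appears[OF c B] assms(2)[OF c B] by blast
  have V: "\<not> rank_one_word V" "initial_segment (v1 0) V" "v1 0 = [0]"
    using c unfolding spacer_rank_two_construction_def by blast+
  then have "V 0 = 0"
    by (simp add: initial_segment_def)
  \<comment> \<open>A rank-one word with the same subshift would yield a construction of
    \<open>V\<close> that contradicts \<open>assms(2)\<close> at level 1.\<close>
  then have "\<not> (\<exists>W. rank_one_word W \<and> X_of V = X_of W)"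
    using rank_one_subshift_construction[OF V(1) rec] assms(2) by blast
  then show ?thesis
    using assms(1) subshift_X_of by (auto simp: spacer_rank_two_system_def)
qed

end
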